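(* For any (finite, simple) graph $F$ and any integers $r\ge p\ge 2$, we have $$\mathrm{ex}_r(n,F^{(r)+})=\mathrm{ex}_p(n,K_r^p,F^{(p)+})+O(n^{r-1})$$ as $n\to\infty$, where the implied constant depends only on $F$, $r$ and $p$.
   Context: An $r$-graph is an $r$-uniform hypergraph. Given a graph $F$ and $r\ge 2$, the $r$-uniform expansion $F^{(r)+}$ is the $r$-graph obtained from $F$ by adding $r-2$ new vertices to each edge of $F$, so that the $(r-2)|E(F)|$ new vertices are pairwise distinct and not in $V(F)$ (so $F^{(2)+}=F$). A hypergraph is $\mathcal{F}$-free if it contains no copy of $\mathcal{F}$ as a (not necessarily induced) subhypergraph. $\mathrm{ex}_r(n,\mathcal{F})$ is the largest number of hyperedges in an $n$-vertex $\mathcal{F}$-free $r$-graph. For $p$-graphs $\mathcal{H}$ and $\mathcal{F}$, $\mathrm{ex}_p(n,\mathcal{H},\mathcal{F})$ is the largest number of copies of $\mathcal{H}$ in an $n$-vertex $\mathcal{F}$-free $p$-graph. $K_r^p$ is the complete $p$-graph on $r$ vertices (all $p$-subsets of an $r$-set are hyperedges). *)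

theory Defs
  imports Complex_Main "HOL-Library.Landau_Symbols"
begin

type_synonym 'a hypergraph = "'a set \<times> 'a set set"

abbreviation verts :: "'a hypergraph \<Rightarrow> 'a set" where "verts \<equiv> fst"
abbreviation hedges :: "'a hypergraph \<Rightarrow> 'a set set" where "hedges \<equiv> snd"

text \<open>Finite \<open>r\<close>-uniform hypergraphs; the case \<open>r = 2\<close> is that of finite simple graphs.\<close>

definition uniform_hypergraph :: "nat \<Rightarrow> 'a hypergraph \<Rightarrow> bool" where
  "uniform_hypergraph r G \<longleftrightarrow>
     finite (verts G) \<and> (\<forall>e \<in> hedges G. e \<subseteq> verts G \<and> card e = r)"

definition isomorphic :: "'a hypergraph \<Rightarrow> 'b hypergraph \<Rightarrow> bool" where
  "isomorphic H G \<longleftrightarrow>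
     (\<exists>f. bij_betw f (verts H) (verts G) \<and> (`) f ` hedges H = hedges G)"

text \<open>The copies of \<open>H\<close> in \<open>G\<close> are unlabelled: they are the (not necessarily induced)
  subhypergraphs of \<open>G\<close> isomorphic to \<open>H\<close>, not the embeddings of \<open>H\<close> into \<open>G\<close>.\<close>

definition copies :: "'a hypergraph \<Rightarrow> 'b hypergraph \<Rightarrow> 'b hypergraph set" where
  "copies H G = {H'. verts H' \<subseteq> verts G \<and> hedges H' \<subseteq> hedges G \<and> isomorphic H H'}"

definition hfree :: "'a hypergraph \<Rightarrow> 'b hypergraph \<Rightarrow> bool" where
  "hfree F G \<longleftrightarrow> copies F G = {}"

text \<open>The vertices added to the edge \<open>e\<close> are \<open>Inr (e, i)\<close> with \<open>i < r - 2\<close>.\<close>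

definition expansion :: "nat \<Rightarrow> 'a hypergraph \<Rightarrow> ('a + 'a set \<times> nat) hypergraph" where
  "expansion r F =
     (Inl ` verts F \<union> Inr ` (hedges F \<times> {..<r - 2}),
      (\<lambda>e. Inl ` e \<union> Inr ` ({e} \<times> {..<r - 2})) ` hedges F)"

definition complete_hypergraph :: "nat \<Rightarrow> nat \<Rightarrow> nat hypergraph" where
  "complete_hypergraph p r = ({..<r}, {e. e \<subseteq> {..<r} \<and> card e = p})"

text \<open>In both extremal numbers below, every \<open>n\<close>-vertex hypergraph is isomorphic to one whose
  vertices are natural numbers. The sets of values are finite, so \<open>Sup\<close> is their maximum;
  if there is no \<open>F\<close>-free hypergraph on \<open>n\<close> vertices (possible only if \<open>F\<close> has no hyperedge),
  the set is empty and its \<open>Sup\<close> is \<open>0\<close>.\<close>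

definition ex_hyp :: "nat \<Rightarrow> nat \<Rightarrow> 'a hypergraph \<Rightarrow> nat" where
  "ex_hyp r n F =
     Sup {card (hedges G) | G :: nat hypergraph.
            uniform_hypergraph r G \<and> card (verts G) = n \<and> hfree F G}"

definition gen_ex_hyp :: "nat \<Rightarrow> nat \<Rightarrow> 'b hypergraph \<Rightarrow> 'a hypergraph \<Rightarrow> nat" where
  "gen_ex_hyp p n H F =
     Sup {card (copies H G) | G :: nat hypergraph.
            uniform_hypergraph p G \<and> card (verts G) = n \<and> hfree F G}"

end

theory Submission
  imports Defs
begin

text \<open>
  If \<open>G\<close> is a \<open>p\<close>-graph without \<open>F\<^sup>(\<^sup>p\<^sup>)\<^sup>+\<close>, then the \<open>r\<close>-graph of its \<open>r\<close>-cliques has no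
  \<open>F\<^sup>(\<^sup>r\<^sup>)\<^sup>+\<close>, because each hyperedge of a copy can be shrunk to \<open>p\<close> vertices around the edge of \<open>F\<close>.
  Hence the generalized extremal number is at most the extremal number.

  Conversely, let \<open>H\<close> be an \<open>r\<close>-graph without \<open>F\<^sup>(\<^sup>r\<^sup>)\<^sup>+\<close>. A \<open>p\<close>-set \<open>A\<close> is bad if all hyperedges
  containing it meet some set of at most \<open>c\<close> vertices outside \<open>A\<close>, so that \<open>A\<close> has degree at most
  \<open>c * n ^ (r - p - 1)\<close>. Deleting, one bad set after the other, all hyperedges that contain it costs
  at most \<open>c * n ^ (r - 1)\<close> hyperedges in total. In the \<open>p\<close>-shadow of what remains every hyperedge
  can be extended while avoiding any \<open>c\<close> prescribed vertices, so a copy of \<open>F\<^sup>(\<^sup>p\<^sup>)\<^sup>+\<close> would extend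
  greedily to a copy of \<open>F\<^sup>(\<^sup>r\<^sup>)\<^sup>+\<close>; and the remaining hyperedges are \<open>r\<close>-cliques of the shadow.
\<close>

section \<open>Copies of expansions and of complete hypergraphs\<close>

text \<open>Unlabelled copies are traded for injective maps, which can be built vertex by vertex;
  the image of such a map is the copy.\<close>

lemma not_hfree_iff_embedding:
  "\<not> hfree H G \<longleftrightarrow>
     (\<exists>f. inj_on f (verts H) \<and> f ` verts H \<subseteq> verts G \<and> (`) f ` hedges H \<subseteq> hedges G)"
proof
  assume "\<not> hfree H G"
  then show "\<exists>f. inj_on f (verts H) \<and> f ` verts H \<subseteq> verts G \<and> (`) f ` hedges H \<subseteq> hedges G"
    unfolding hfree_def copies_def isomorphic_def bij_betw_def by fastforce
next
  assume "\<exists>f. inj_on f (verts H) \<and> f ` verts H \<subseteq> verts G \<and> (`) f ` hedges H \<subseteq> hedges G"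
  then obtain f where "inj_on f (verts H)" "f ` verts H \<subseteq> verts G" "(`) f ` hedges H \<subseteq> hedges G"
    by blast
  then have "(f ` verts H, (`) f ` hedges H) \<in> copies H G"
    unfolding copies_def isomorphic_def bij_betw_def by auto
  then show "\<not> hfree H G"
    unfolding hfree_def by blast
qed

text \<open>\<open>B e\<close> is the hyperedge of the copy that expands the edge \<open>e\<close> of \<open>F\<close>. The uniformity \<open>r\<close> does
  not occur, which allows enlarging and shrinking the hyperedges \<open>B e\<close>.\<close>

definition expands ::
  "'a hypergraph \<Rightarrow> 'b hypergraph \<Rightarrow> ('a \<Rightarrow> 'b) \<Rightarrow> ('a set \<Rightarrow> 'b set) \<Rightarrow> bool" where
  "expands F G \<phi> B \<longleftrightarrow>
     inj_on \<phi> (verts F) \<and> \<phi> ` verts F \<subseteq> verts G \<and>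
     (\<forall>e\<in>hedges F. B e \<in> hedges G \<and> B e \<inter> \<phi> ` verts F = \<phi> ` e) \<and>
     (\<forall>e\<in>hedges F. \<forall>e'\<in>hedges F. e \<noteq> e' \<longrightarrow> B e \<inter> B e' \<subseteq> \<phi> ` verts F)"

text \<open>The set \<open>B e\<close> is the image of the expanded edge \<open>e\<close>. Two
  expanded edges share only vertices of \<open>F\<close>, and injectivity carries intersections over
  to the images.\<close>

lemma expands_if_not_hfree_expansion:
  assumes F: "uniform_hypergraph 2 F" and "\<not> hfree (expansion r F) G"
  obtains \<phi> B where "expands F G \<phi> B"
proof -
  let ?V = "verts (expansion r F)"
  from assms obtain f where inj: "inj_on f ?V"
    and V: "f ` ?V \<subseteq> verts G" and E: "(`) f ` hedges (expansion r F) \<subseteq> hedges G"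
    unfolding not_hfree_iff_embedding by blast
  define b where "b e = Inl ` e \<union> Inr ` ({e} \<times> {..<r - 2})" for e :: "'a set"
  have FV: "e \<subseteq> verts F" if "e \<in> hedges F" for e
    using F that unfolding uniform_hypergraph_def by auto
  have b: "b e \<subseteq> ?V" if "e \<in> hedges F" for e
    using FV[OF that] that unfolding b_def expansion_def by auto
  have I: "Inl ` verts F \<subseteq> ?V"
    unfolding expansion_def by auto
  have "inj_on (f \<circ> Inl) (verts F)"
    using inj_on_subset[OF inj I] by (auto simp: inj_on_def)
  moreover have "(f \<circ> Inl) ` verts F \<subseteq> verts G"
    using V I by auto
  moreover have "f ` b e \<in> hedges G" if "e \<in> hedges F" for e
    using E that unfolding b_def expansion_def by auto
  moreover have "f ` b e \<inter> (f \<circ> Inl) ` verts F = (f \<circ> Inl) ` e" if e: "e \<in> hedges F" for e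
  proof -
    have "b e \<inter> Inl ` verts F = Inl ` e"
      using FV[OF e] unfolding b_def by auto
    then show ?thesis
      using inj_on_image_Int[OF inj b[OF e] I] by (simp add: image_comp)
  qed
  moreover have "f ` b e \<inter> f ` b e' \<subseteq> (f \<circ> Inl) ` verts F"
    if e: "e \<in> hedges F" "e' \<in> hedges F" "e \<noteq> e'" for e e'
  proof -
    have "b e \<inter> b e' \<subseteq> Inl ` verts F"
      using FV[OF e(1)] e(3) unfolding b_def by auto
    then have "f ` (b e \<inter> b e') \<subseteq> f ` Inl ` verts F"
      by (rule image_mono)
    then show ?thesis
      using inj_on_image_Int[OF inj b[OF e(1)] b[OF e(2)]] by (simp add: image_comp)
  qed
  ultimately have "expands F G (f \<circ> Inl) (\<lambda>e. f ` b e)"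
    unfolding expands_def by (intro conjI ballI impI)
  then show thesis ..
qed

text \<open>Uniformity leaves exactly \<open>r - 2\<close> vertices of \<open>B e\<close> outside
  the image of \<open>e\<close>, and these receive the new vertices of \<open>e\<close>. The
  leftover sets are disjoint from the image of \<open>verts F\<close> and from one another, which
  makes the combined map injective.\<close>

lemma not_hfree_expansion_if_expands:
  assumes F: "uniform_hypergraph 2 F" and G: "uniform_hypergraph r G"
    and "expands F G \<phi> B"
  shows "\<not> hfree (expansion r F) G"
proof -
  have inj: "inj_on \<phi> (verts F)" and V: "\<phi> ` verts F \<subseteq> verts G"
    and B: "\<And>e. e \<in> hedges F \<Longrightarrow> B e \<in> hedges G"
    and BV: "\<And>e. e \<in> hedges F \<Longrightarrow> B e \<inter> \<phi> ` verts F = \<phi> ` e"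
    and BB: "\<And>e e'. e \<in> hedges F \<Longrightarrow> e' \<in> hedges F \<Longrightarrow> e \<noteq> e' \<Longrightarrow> B e \<inter> B e' \<subseteq> \<phi> ` verts F"
    using assms(3) unfolding expands_def by auto
  have FE: "e \<subseteq> verts F" "card e = 2" if "e \<in> hedges F" for e
    using F that unfolding uniform_hypergraph_def by auto
  have "\<exists>h. bij_betw h {..<r - 2} (B e - \<phi> ` e)" if e: "e \<in> hedges F" for e
  proof -
    have "B e \<subseteq> verts G" "card (B e) = r" "finite (verts G)"
      using G B[OF e] unfolding uniform_hypergraph_def by auto
    moreover have "card (\<phi> ` e) = 2"
      using FE[OF e] inj by (metis card_image inj_on_subset)
    moreover have "\<phi> ` e \<subseteq> B e"
      using BV[OF e] by blast
    ultimately have "finite (B e - \<phi> ` e)" "card (B e - \<phi> ` e) = r - 2"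
      by (auto simp: card_Diff_subset finite_subset)
    then show ?thesis
      using ex_bij_betw_nat_finite[of "B e - \<phi> ` e"] by (simp add: atLeast0LessThan)
  qed
  then obtain h where h: "\<And>e. e \<in> hedges F \<Longrightarrow> bij_betw (h e) {..<r - 2} (B e - \<phi> ` e)"
    by metis
  define f where "f = case_sum \<phi> (\<lambda>(e, i). h e i)"
  have hB: "h e i \<in> B e" "h e i \<notin> \<phi> ` verts F" if "e \<in> hedges F" "i < r - 2" for e i
    using h[OF that(1)] BV[OF that(1)] that(2) unfolding bij_betw_def by auto
  have hh: "e = e' \<and> i = j"
    if e: "e \<in> hedges F" "e' \<in> hedges F" and i: "i < r - 2" "j < r - 2" and eq: "h e i = h e' j"
    for e e' i j
  proof -
    have "e = e'"
    proof (rule ccontr)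
      assume "e \<noteq> e'"
      then have "h e i \<in> \<phi> ` verts F"
        using BB[OF e] hB(1)[OF e(1) i(1)] hB(1)[OF e(2) i(2)] eq by auto
      then show False
        using hB(2)[OF e(1) i(1)] by blast
    qed
    moreover from this have "i = j"
      using h[OF e(1)] i eq unfolding bij_betw_def inj_on_def by auto
    ultimately show ?thesis ..
  qed
  have verts_expansion: "verts (expansion r F) = Inl ` verts F \<union> Inr ` (hedges F \<times> {..<r - 2})"
    unfolding expansion_def by simp
  have sep: "f (Inl v) \<noteq> f (Inr (e, i))" if "v \<in> verts F" "e \<in> hedges F" "i < r - 2" for v e i
    using hB(2)[OF that(2,3)] imageI[OF that(1), of \<phi>] unfolding f_def by auto
  have "inj_on f (Inl ` verts F)"
    using inj unfolding f_def inj_on_def by auto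
  moreover have "inj_on f (Inr ` (hedges F \<times> {..<r - 2}))"
    unfolding f_def by (rule inj_onI) (auto dest: hh)
  moreover have "f ` (Inl ` verts F - Inr ` (hedges F \<times> {..<r - 2})) \<inter>
      f ` (Inr ` (hedges F \<times> {..<r - 2}) - Inl ` verts F) = {}"
    using sep sep[symmetric] by (intro Int_emptyI) auto
  ultimately have "inj_on f (verts (expansion r F))"
    unfolding verts_expansion inj_on_Un by (intro conjI)
  moreover have "f ` (Inl ` e \<union> Inr ` ({e} \<times> {..<r - 2})) = B e" if e: "e \<in> hedges F" for e
  proof -
    have "{e} \<times> {..<r - 2} = Pair e ` {..<r - 2}"
      by auto
    then have "f ` (Inl ` e \<union> Inr ` ({e} \<times> {..<r - 2})) = \<phi> ` e \<union> h e ` {..<r - 2}"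
      unfolding f_def by (simp add: image_Un image_image)
    also have "\<dots> = B e"
      using h[OF e] BV[OF e] unfolding bij_betw_def by auto
    finally show ?thesis .
  qed
  then have "(`) f ` hedges (expansion r F) \<subseteq> hedges G"
    using B unfolding expansion_def by auto
  moreover have "f ` verts (expansion r F) \<subseteq> verts G"
  proof -
    have "B e \<subseteq> verts G" if "e \<in> hedges F" for e
      using G B[OF that] unfolding uniform_hypergraph_def by auto
    then have "h e i \<in> verts G" if "e \<in> hedges F" "i < r - 2" for e i
      using hB(1) that by blast
    then show ?thesis
      using V unfolding expansion_def f_def by auto
  qed
  ultimately show ?thesis
    unfolding not_hfree_iff_embedding by blast
qed

section \<open>Copies of a complete hypergraph as cliques\<close>

definition cliques :: "nat \<Rightarrow> nat \<Rightarrow> 'a hypergraph \<Rightarrow> 'a set set" where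
  "cliques p r G = {S. S \<subseteq> verts G \<and> card S = r \<and> (\<forall>e. e \<subseteq> S \<and> card e = p \<longrightarrow> e \<in> hedges G)}"

lemma image_subsets_of_card:
  assumes "bij_betw f S T"
  shows "(`) f ` {e. e \<subseteq> S \<and> card e = p} = {e. e \<subseteq> T \<and> card e = p}"
proof -
  have T: "f ` S = T" and card: "\<And>e. e \<subseteq> S \<Longrightarrow> card (f ` e) = card e"
    using assms card_image inj_on_subset unfolding bij_betw_def by blast+
  show ?thesis
  proof (intro equalityI subsetI)
    fix d assume "d \<in> (`) f ` {e. e \<subseteq> S \<and> card e = p}"
    then obtain e where "e \<subseteq> S" "card e = p" "d = f ` e"
      by blast
    then show "d \<in> {e. e \<subseteq> T \<and> card e = p}"
      using T card[of e] by auto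
  next
    fix d assume d: "d \<in> {e. e \<subseteq> T \<and> card e = p}"
    then obtain e where "e \<subseteq> S" "d = f ` e"
      using T by (auto elim: subset_imageE)
    then show "d \<in> (`) f ` {e. e \<subseteq> S \<and> card e = p}"
      using d card[of e] by auto
  qed
qed

text \<open>A copy is determined by its vertex set, since its hyperedges must be all
  \<open>p\<close>-subsets of that set. Counting unlabelled copies thus amounts to counting cliques,
  which can serve as hyperedges of an \<open>r\<close>-graph.\<close>

lemma copies_complete_hypergraph:
  assumes "finite (verts G)"
  shows "copies (complete_hypergraph p r) G =
    (\<lambda>S. (S, {e. e \<subseteq> S \<and> card e = p})) ` cliques p r G" (is "?L = ?c ` _")
proof (intro equalityI subsetI)
  fix H assume H: "H \<in> ?L"
  then obtain f where f: "bij_betw f {..<r} (verts H)"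
    and "(`) f ` {e. e \<subseteq> {..<r} \<and> card e = p} = hedges H"
    unfolding copies_def isomorphic_def complete_hypergraph_def by auto
  then have E: "hedges H = {e. e \<subseteq> verts H \<and> card e = p}"
    using image_subsets_of_card[OF f] by simp
  have "card (verts H) = r"
    using bij_betw_same_card[OF f] by simp
  then have "verts H \<in> cliques p r G"
    using H E unfolding cliques_def copies_def by auto
  moreover have "H = ?c (verts H)"
    using E by (metis prod.collapse)
  ultimately show "H \<in> ?c ` cliques p r G"
    by blast
next
  fix H assume "H \<in> ?c ` cliques p r G"
  then obtain S where S: "S \<in> cliques p r G" "H = ?c S"
    by blast
  then have "finite S" "card S = r"
    using assms unfolding cliques_def by (auto intro: finite_subset)
  then obtain f where f: "bij_betw f {..<r} S"
    by (metis atLeast0LessThan ex_bij_betw_nat_finite)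
  have "isomorphic (complete_hypergraph p r) H"
    unfolding isomorphic_def complete_hypergraph_def
    using f image_subsets_of_card[OF f] S(2) by (intro exI[of _ f]) simp
  then show "H \<in> ?L"
    using S unfolding copies_def cliques_def by auto
qed

lemma card_copies_complete_hypergraph:
  assumes "finite (verts G)"
  shows "card (copies (complete_hypergraph p r) G) = card (cliques p r G)"
  unfolding copies_complete_hypergraph[OF assms] by (rule card_image) (auto simp: inj_on_def)

section \<open>Comparison with the hypergraph of cliques\<close>

lemma hfree_hypergraph_of_cliques:
  assumes F: "uniform_hypergraph 2 F" and G: "uniform_hypergraph p G"
    and "2 \<le> p" "p \<le> r" and free: "hfree (expansion p F) G"
  shows "hfree (expansion r F) (verts G, cliques p r G)"
proof (rule ccontr)
  assume "\<not> ?thesis"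
  then obtain \<phi> B where ex: "expands F (verts G, cliques p r G) \<phi> B"
    using expands_if_not_hfree_expansion[OF F] by blast
  \<comment> \<open>Since \<open>2 \<le> p\<close> and \<open>p \<le> r\<close>, a
    \<open>p\<close>-set fits between the image of \<open>e\<close> and \<open>B e\<close>. It is a
    hyperedge of \<open>G\<close> because \<open>B e\<close> is a clique, and shrinking towards the
    image of \<open>e\<close> preserves the conditions on intersections.\<close>
  have "\<exists>B'. \<phi> ` e \<subseteq> B' \<and> B' \<subseteq> B e \<and> card B' = p" if e: "e \<in> hedges F" for e
  proof -
    have "card (B e) = r" "B e \<subseteq> verts G" "B e \<inter> \<phi> ` verts F = \<phi> ` e"
      using ex e unfolding expands_def cliques_def by auto
    moreover from this(3) have "\<phi> ` e \<subseteq> B e"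
      by blast
    moreover have "finite (verts G)"
      using G unfolding uniform_hypergraph_def by simp
    moreover have "card (\<phi> ` e) = 2"
      using F ex e unfolding uniform_hypergraph_def expands_def
      by (metis card_image inj_on_subset)
    ultimately show ?thesis
      using exists_subset_between[of "\<phi> ` e" p "B e"] assms(3,4) by (metis finite_subset)
  qed
  then obtain B' where B': "\<And>e. e \<in> hedges F \<Longrightarrow> \<phi> ` e \<subseteq> B' e \<and> B' e \<subseteq> B e \<and> card (B' e) = p"
    by metis
  have "B' e \<in> hedges G" if "e \<in> hedges F" for e
    using ex B'[OF that] that unfolding expands_def cliques_def by auto
  moreover have "B' e \<inter> \<phi> ` verts F = \<phi> ` e" if "e \<in> hedges F" for e
  proof -
    have "B e \<inter> \<phi> ` verts F = \<phi> ` e"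
      using ex that unfolding expands_def by auto
    then show ?thesis
      using B'[OF that] by blast
  qed
  moreover have "B' e \<inter> B' e' \<subseteq> \<phi> ` verts F"
    if e: "e \<in> hedges F" "e' \<in> hedges F" "e \<noteq> e'" for e e'
  proof -
    have "B e \<inter> B e' \<subseteq> \<phi> ` verts F"
      using ex e unfolding expands_def by auto
    then show ?thesis
      using B'[OF e(1)] B'[OF e(2)] by blast
  qed
  ultimately have "expands F G \<phi> B'"
    using ex unfolding expands_def by auto
  then show False
    using not_hfree_expansion_if_expands[OF F G] free by blast
qed

section \<open>Extremal numbers as suprema of bounded sets\<close>

lemma card_hedges_le_ex_hyp:
  fixes G :: "nat hypergraph"
  assumes "uniform_hypergraph r G" "card (verts G) = n" "hfree F G"
  shows "card (hedges G) \<le> ex_hyp r n F"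
  unfolding ex_hyp_def
proof (rule cSup_upper)
  \<comment> \<open>\<open>Sup\<close> on naturals is known to be an upper bound only for a bounded
    set. Hyperedges are subsets of an \<open>n\<close>-set, hence the bound
    \<open>2 ^ n\<close>.\<close>
  have "card (hedges H) \<le> 2 ^ n"
    if "uniform_hypergraph r H" "card (verts H) = n" for H :: "nat hypergraph"
  proof -
    have "hedges H \<subseteq> Pow (verts H)" "finite (verts H)"
      using that unfolding uniform_hypergraph_def by auto
    then show ?thesis
      using card_mono[of "Pow (verts H)" "hedges H"] that(2) by (simp add: card_Pow)
  qed
  then show "bdd_above {card (hedges G) | G :: nat hypergraph.
      uniform_hypergraph r G \<and> card (verts G) = n \<and> hfree F G}"
    by (intro bdd_aboveI[of _ "2 ^ n"]) auto
qed (use assms in blast)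

lemma finite_cliques: "finite (verts G) \<Longrightarrow> finite (cliques p r G)"
  unfolding cliques_def by (rule finite_subset[of _ "Pow (verts G)"]) auto

lemma card_cliques_le_gen_ex_hyp:
  fixes G :: "nat hypergraph"
  assumes "uniform_hypergraph p G" "card (verts G) = n" "hfree F G"
  shows "card (cliques p r G) \<le> gen_ex_hyp p n (complete_hypergraph p r) F"
proof -
  have card_eq: "card (copies (complete_hypergraph p r) H) = card (cliques p r H)"
    if "uniform_hypergraph p H" for H :: "nat hypergraph"
    using that card_copies_complete_hypergraph unfolding uniform_hypergraph_def by blast
  have "card (copies (complete_hypergraph p r) G) \<le> gen_ex_hyp p n (complete_hypergraph p r) F"
    unfolding gen_ex_hyp_def
  proof (rule cSup_upper)
    \<comment> \<open>The same bound works here, because copies are counted by cliques and these are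
      sets of vertices.\<close>
    have "card (copies (complete_hypergraph p r) H) \<le> 2 ^ n"
      if "uniform_hypergraph p H" "card (verts H) = n" for H :: "nat hypergraph"
    proof -
      have "cliques p r H \<subseteq> Pow (verts H)" "finite (verts H)"
        using that unfolding uniform_hypergraph_def cliques_def by auto
      then show ?thesis
        using card_mono[of "Pow (verts H)" "cliques p r H"] that
        by (simp add: card_Pow card_eq)
    qed
    then show "bdd_above {card (copies (complete_hypergraph p r) G) | G :: nat hypergraph.
        uniform_hypergraph p G \<and> card (verts G) = n \<and> hfree F G}"
      by (intro bdd_aboveI[of _ "2 ^ n"]) auto
  qed (use assms in blast)
  then show ?thesis
    using card_eq[OF assms(1)] by simp
qed

text \<open>Covers the empty set as well, whose \<open>Sup\<close> is 0; it arises when no free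
  hypergraph on \<open>n\<close> vertices exists.\<close>

lemma Sup_nat_le:
  fixes S :: "nat set"
  assumes "\<And>x. x \<in> S \<Longrightarrow> x \<le> b"
  shows "Sup S \<le> b"
proof (cases "S = {}")
  case True
  then show ?thesis by (simp add: Sup_nat_def)
next
  case False
  then show ?thesis using assms by (rule cSup_least)
qed

lemma gen_ex_hyp_le_ex_hyp:
  assumes F: "uniform_hypergraph 2 F" and "2 \<le> p" "p \<le> r"
  shows "gen_ex_hyp p n (complete_hypergraph p r) (expansion p F) \<le> ex_hyp r n (expansion r F)"
  unfolding gen_ex_hyp_def
proof (rule Sup_nat_le)
  fix x
  assume "x \<in> {card (copies (complete_hypergraph p r) G) | G :: nat hypergraph.
    uniform_hypergraph p G \<and> card (verts G) = n \<and> hfree (expansion p F) G}"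
  then obtain V :: "nat set" and E where x: "x = card (copies (complete_hypergraph p r) (V, E))"
    and G: "uniform_hypergraph p (V, E)" and n: "card V = n"
    and free: "hfree (expansion p F) (V, E)"
    by auto
  \<comment> \<open>This competitor for \<open>ex_hyp\<close> has the same \<open>n\<close> vertices
    and one hyperedge for each copy of the complete hypergraph.\<close>
  let ?C = "(V, cliques p r (V, E))"
  have fin: "finite V"
    using G unfolding uniform_hypergraph_def by simp
  then have "uniform_hypergraph r ?C"
    unfolding uniform_hypergraph_def cliques_def by auto
  then show "x \<le> ex_hyp r n (expansion r F)"
    using card_hedges_le_ex_hyp[of r ?C n "expansion r F"] n fin
      hfree_hypergraph_of_cliques[OF F G assms(2,3) free] card_copies_complete_hypergraph[of "(V, E)" p r]
    by (simp add: x)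
qed

section \<open>Deleting the hyperedges over bad sets\<close>

definition shadow :: "nat \<Rightarrow> 'a set set \<Rightarrow> 'a set set" where
  "shadow p E = {A. card A = p \<and> (\<exists>B\<in>E. A \<subseteq> B)}"

text \<open>The bad sets are those that are not extendable. Only \<open>X\<close> disjoint from
  \<open>A\<close> can be avoided, as \<open>B\<close> contains \<open>A\<close>.\<close>

definition extendable :: "nat \<Rightarrow> 'a set set \<Rightarrow> 'a set \<Rightarrow> bool" where
  "extendable c E A \<longleftrightarrow>
     (\<forall>X. finite X \<and> card X \<le> c \<and> X \<inter> A = {} \<longrightarrow> (\<exists>B\<in>E. A \<subseteq> B \<and> B \<inter> X = {}))"

text \<open>Deleting all hyperedges over a bad set removes that set from the shadow for good, so
  there are at most \<open>card (shadow p E)\<close> rounds, each costing at most \<open>K\<close>.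
  The degree bound is assumed for every subfamily because deletions can turn further sets
  bad.\<close>

lemma exists_extendable_subset:
  assumes "finite E" and "finite (shadow p E)"
    and "\<And>E' A. E' \<subseteq> E \<Longrightarrow> A \<in> shadow p E' \<Longrightarrow> \<not> extendable c E' A \<Longrightarrow> card {B\<in>E'. A \<subseteq> B} \<le> K"
  shows "\<exists>E'\<subseteq>E. (\<forall>A\<in>shadow p E'. extendable c E' A) \<and> card E \<le> card E' + card (shadow p E) * K"
  using assms
proof (induction "card (shadow p E)" arbitrary: E rule: less_induct)
  case less
  show ?case
  proof (cases "\<forall>A\<in>shadow p E. extendable c E A")
    case True
    then show ?thesis by auto
  next
    case False
    then obtain A where A: "A \<in> shadow p E" "\<not> extendable c E A"
      by blast
    define E1 where "E1 = {B\<in>E. \<not> A \<subseteq> B}"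
    have "E1 \<subseteq> E"
      unfolding E1_def by auto
    have sh: "shadow p E1 \<subseteq> shadow p E - {A}"
      unfolding E1_def shadow_def by auto
    then have "card (shadow p E1) \<le> card (shadow p E - {A})"
      using less.prems(2) by (intro card_mono) auto
    moreover have "Suc (card (shadow p E - {A})) = card (shadow p E)"
      using A(1) less.prems(2) by (intro card.remove[symmetric])
    ultimately have lt: "Suc (card (shadow p E1)) \<le> card (shadow p E)"
      by simp
    have "\<exists>E'\<subseteq>E1. (\<forall>A\<in>shadow p E'. extendable c E' A)
        \<and> card E1 \<le> card E' + card (shadow p E1) * K"
    proof (rule less.hyps)
      show "card (shadow p E1) < card (shadow p E)" using lt by simp
      show "finite E1" using less.prems(1) \<open>E1 \<subseteq> E\<close> finite_subset by blast
      show "finite (shadow p E1)" using less.prems(2) sh finite_subset by blast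
    qed (use less.prems(3) \<open>E1 \<subseteq> E\<close> in blast)
    then obtain E' where E': "E' \<subseteq> E1" "\<forall>A\<in>shadow p E'. extendable c E' A"
      "card E1 \<le> card E' + card (shadow p E1) * K"
      by blast
    have "E = E1 \<union> {B\<in>E. A \<subseteq> B}"
      unfolding E1_def by auto
    then have "card E \<le> card E1 + card {B\<in>E. A \<subseteq> B}"
      by (metis card_Un_le)
    also have "card {B\<in>E. A \<subseteq> B} \<le> K"
      using less.prems(3)[OF subset_refl A] .
    finally have "card E \<le> card E' + Suc (card (shadow p E1)) * K"
      using E'(3) by simp
    also have "Suc (card (shadow p E1)) * K \<le> card (shadow p E) * K"
      using lt by (rule mult_right_mono) simp
    finally show ?thesis
      using E' \<open>E1 \<subseteq> E\<close> by auto
  qed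
qed

section \<open>Counting the hyperedges over a set\<close>

lemma card_subsets_le_power:
  assumes "finite V"
  shows "card {S. S \<subseteq> V \<and> card S = k} \<le> card V ^ k"
proof -
  have "card V choose k \<le> card V ^ k"
    by (cases "k \<le> card V") (simp_all add: binomial_le_pow binomial_eq_0)
  then show ?thesis
    using n_subsets[OF assms] by simp
qed

lemma card_supersets_le_power:
  assumes "finite V" and "\<And>B. B \<in> E \<Longrightarrow> B \<subseteq> V \<and> card B = r" and "finite S"
  shows "card {B\<in>E. S \<subseteq> B} \<le> card V ^ (r - card S)"
proof -
  have "card {B\<in>E. S \<subseteq> B} \<le> card {T. T \<subseteq> V \<and> card T = r - card S}"
  proof (rule card_inj_on_le)
    show "inj_on (\<lambda>B. B - S) {B\<in>E. S \<subseteq> B}"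
      by (auto simp: inj_on_def)
    show "(\<lambda>B. B - S) ` {B\<in>E. S \<subseteq> B} \<subseteq> {T. T \<subseteq> V \<and> card T = r - card S}"
      using assms(2) by (auto simp: card_Diff_subset[OF assms(3)])
    show "finite {T. T \<subseteq> V \<and> card T = r - card S}"
      using assms(1) by simp
  qed
  also have "\<dots> \<le> card V ^ (r - card S)"
    using card_subsets_le_power[OF assms(1)] .
  finally show ?thesis .
qed

text \<open>Every hyperedge over \<open>A\<close> contains one of at most \<open>c\<close> further
  vertices \<open>x\<close>, and fixing \<open>x\<close> as well as \<open>A\<close> lowers the
  exponent by one.\<close>

lemma card_supersets_if_not_extendable:
  assumes V: "finite V" and E: "\<And>B. B \<in> E \<Longrightarrow> B \<subseteq> V \<and> card B = r"
    and A: "finite A" "\<not> extendable c E A"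
  shows "card {B\<in>E. A \<subseteq> B} \<le> c * card V ^ (r - card A - 1)"
proof -
  from A(2) obtain X where X: "finite X" "card X \<le> c" "X \<inter> A = {}"
    and meets: "\<forall>B\<in>E. A \<subseteq> B \<longrightarrow> B \<inter> X \<noteq> {}"
    unfolding extendable_def by auto
  have finE: "finite E"
    using V E by (intro finite_subset[of E "Pow V"]) auto
  have "card {B\<in>E. A \<subseteq> B} \<le> card (\<Union>x\<in>X. {B\<in>E. insert x A \<subseteq> B})"
    using meets X(1) finE by (intro card_mono) auto
  also have "\<dots> \<le> (\<Sum>x\<in>X. card {B\<in>E. insert x A \<subseteq> B})"
    by (rule card_UN_le[OF X(1)])
  also have "\<dots> \<le> (\<Sum>x\<in>X. card V ^ (r - card A - 1))"
  proof (rule sum_mono)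
    fix x assume "x \<in> X"
    then have "card (insert x A) = Suc (card A)"
      using X(3) A(1) by (intro card_insert_disjoint) auto
    then show "card {B\<in>E. insert x A \<subseteq> B} \<le> card V ^ (r - card A - 1)"
      using card_supersets_le_power[OF V E, where S = "insert x A"] A(1) by simp
  qed
  also have "\<dots> \<le> c * card V ^ (r - card A - 1)"
    using X(2) by simp
  finally show ?thesis .
qed

lemma exists_extendable_subhypergraph:
  assumes H: "uniform_hypergraph r (V, E)" and "p \<le> r" and p: "0 < p"
  shows "\<exists>E'\<subseteq>E. (\<forall>A\<in>shadow p E'. extendable c E' A) \<and> card E \<le> card E' + c * card V ^ (r - 1)"
proof -
  have V: "finite V" and E: "\<And>B. B \<in> E \<Longrightarrow> B \<subseteq> V \<and> card B = r"
    using H unfolding uniform_hypergraph_def by auto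
  show ?thesis
  proof (cases "p = r")
    case True
    \<comment> \<open>For \<open>p = r\<close> the exponent \<open>r - p - 1\<close> truncates to 0
      and the general count would only give \<open>c * card V ^ r\<close>. But a set in the shadow
      is then itself a hyperedge, disjoint from every admissible \<open>X\<close>, so nothing is
      deleted.\<close>
    have "extendable c E A" if A: "A \<in> shadow p E" for A
    proof -
      obtain B where B: "B \<in> E" "A \<subseteq> B" "card A = p"
        using A unfolding shadow_def by blast
      then have "A = B"
        using E[of B] V True by (metis card_subset_eq finite_subset)
      then show ?thesis
        using B(1) unfolding extendable_def by auto
    qed
    then show ?thesis by auto
  next
    case False
    let ?K = "c * card V ^ (r - p - 1)"
    have finE: "finite E"
      using V E by (intro finite_subset[of E "Pow V"]) auto
    have sh: "shadow p E \<subseteq> {A. A \<subseteq> V \<and> card A = p}"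
      using E unfolding shadow_def by auto
    then have finS: "finite (shadow p E)"
      using V by (auto intro: finite_subset)
    have "card {B\<in>E'. A \<subseteq> B} \<le> ?K"
      if "E' \<subseteq> E" "A \<in> shadow p E'" "\<not> extendable c E' A" for E' A
    proof -
      have "card A = p"
        using that(2) unfolding shadow_def by simp
      \<comment> \<open>Infinite sets have \<open>card\<close> 0, so a set of positive cardinality
        \<open>p\<close> is finite.\<close>
      moreover from this have "finite A"
        using p by (metis card.infinite less_numeral_extra(3))
      ultimately show ?thesis
        using card_supersets_if_not_extendable[of V E' r A c] V E that by blast
    qed
    from exists_extendable_subset[OF finE finS this]
    obtain E' where E': "E' \<subseteq> E" "\<forall>A\<in>shadow p E'. extendable c E' A"
      "card E \<le> card E' + card (shadow p E) * ?K"
      by blast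
    have "card (shadow p E) \<le> card V ^ p"
      using card_mono[OF _ sh] card_subsets_le_power[OF V, of p] V by fastforce
    then have "card (shadow p E) * ?K \<le> card V ^ p * ?K"
      by (rule mult_right_mono) simp
    also have "\<dots> = c * card V ^ (p + (r - p - 1))"
      by (simp add: power_add)
    also have "p + (r - p - 1) = r - 1"
      using False assms(2) by simp
    finally show ?thesis
      using E' by (meson add_left_mono order_trans)
  qed
qed

section \<open>Greedy extension from the shadow to the hypergraph\<close>

lemma expands_if_expands_shadow:
  assumes F: "uniform_hypergraph 2 F" and H: "uniform_hypergraph r (V, E)"
    and "p \<le> r" and p: "0 < p"
    and extend: "\<And>A. A \<in> shadow p E \<Longrightarrow> extendable (card (verts F) + card (hedges F) * r) E A"
    and A: "expands F (V, shadow p E) \<phi> A"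
  obtains B where "expands F (V, E) \<phi> B"
proof -
  let ?W = "\<phi> ` verts F"
  have finF: "finite (verts F)"
    using F unfolding uniform_hypergraph_def by simp
  have finE: "finite (hedges F)"
    using F unfolding uniform_hypergraph_def by (auto intro: finite_subset[of _ "Pow (verts F)"])
  \<comment> \<open>The sets are enlarged one at a time: those for edges in \<open>D\<close> are
    already hyperedges of \<open>E\<close>, the others are still \<open>p\<close>-sets of the
    shadow, and the mixed family keeps the intersection conditions.\<close>
  have "\<exists>B. (\<forall>e\<in>D. B e \<in> E) \<and> (\<forall>e\<in>hedges F - D. B e \<in> shadow p E) \<and>
      (\<forall>e\<in>hedges F. B e \<inter> ?W = \<phi> ` e) \<and>
      (\<forall>e\<in>hedges F. \<forall>e'\<in>hedges F. e \<noteq> e' \<longrightarrow> B e \<inter> B e' \<subseteq> ?W)"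
    if "finite D" "D \<subseteq> hedges F" for D
    using that
  proof (induction D rule: finite_induct)
    case empty
    then show ?case
      using A unfolding expands_def by (intro exI[of _ A]) simp
  next
    case (insert d D)
    have "D \<subseteq> hedges F"
      using insert.prems by simp
    from insert.IH[OF this] obtain B where B: "\<forall>e\<in>D. B e \<in> E" "\<forall>e\<in>hedges F - D. B e \<in> shadow p E"
      "\<forall>e\<in>hedges F. B e \<inter> ?W = \<phi> ` e"
      "\<forall>e\<in>hedges F. \<forall>e'\<in>hedges F. e \<noteq> e' \<longrightarrow> B e \<inter> B e' \<subseteq> ?W"
      by (elim exE conjE)
    have BD: "B e \<in> E" if "e \<in> D" for e
      using B(1) that by blast
    have BS: "B e \<in> shadow p E" if "e \<in> hedges F - D" for e
      using B(2) that by blast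
    have BW: "B e \<inter> ?W = \<phi> ` e" if "e \<in> hedges F" for e
      using B(3) that by blast
    have BB: "B e \<inter> B e' \<subseteq> ?W" if "e \<in> hedges F" "e' \<in> hedges F" "e \<noteq> e'" for e e'
      using B(4) that by blast
    \<comment> \<open>The enlargement of \<open>B d\<close> must gain no vertex from the image of
      \<open>verts F\<close> or from any current \<open>B e\<close>. Each \<open>B e\<close> has at
      most \<open>r\<close> vertices, enlarged or not, which gives the constant in the hypothesis on
      extendability.\<close>
    define X where "X = (?W \<union> (\<Union>e\<in>hedges F. B e)) - B d"
    have B_le: "finite (B e) \<and> card (B e) \<le> r" if "e \<in> hedges F" for e
    proof (cases "e \<in> D")
      case True
      then show ?thesis
        using BD[OF True] H unfolding uniform_hypergraph_def by (auto intro: finite_subset)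
    next
      case False
      then have "card (B e) = p"
        using BS that unfolding shadow_def by auto
      then show ?thesis
        using p assms(3) by (auto intro: card_ge_0_finite)
    qed
    have fin: "finite (?W \<union> (\<Union>e\<in>hedges F. B e))"
      using finF finE B_le by auto
    have "card X \<le> card (?W \<union> (\<Union>e\<in>hedges F. B e))"
      unfolding X_def using fin by (intro card_mono) auto
    also have "\<dots> \<le> card ?W + card (\<Union>e\<in>hedges F. B e)"
      by (rule card_Un_le)
    also have "card ?W \<le> card (verts F)"
      using finF by (rule card_image_le)
    also have "card (\<Union>e\<in>hedges F. B e) \<le> (\<Sum>e\<in>hedges F. card (B e))"
      by (rule card_UN_le[OF finE])
    also have "\<dots> \<le> card (hedges F) * r"
      using sum_bounded_above[of "hedges F" "\<lambda>e. card (B e)" r] B_le by simp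
    finally have "card X \<le> card (verts F) + card (hedges F) * r"
      by simp
    moreover have "finite X" "X \<inter> B d = {}"
      using fin unfolding X_def by auto
    moreover have "B d \<in> shadow p E"
      using BS insert.hyps insert.prems by auto
    ultimately obtain C where C: "C \<in> E" "B d \<subseteq> C" "C \<inter> X = {}"
      using extend unfolding extendable_def by blast
    have d: "d \<in> hedges F"
      using insert.prems by simp
    \<comment> \<open>As \<open>C\<close> misses \<open>X\<close>, it meets the image of
      \<open>verts F\<close> and the other sets \<open>B e\<close> only inside \<open>B d\<close>,
      so the conditions for \<open>B d\<close> pass to \<open>C\<close>.\<close>
    have CW: "C \<inter> ?W = \<phi> ` d"
      using C BW[OF d] unfolding X_def by blast
    have CB: "C \<inter> B e \<subseteq> ?W" if "e \<in> hedges F" "e \<noteq> d" for e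
      using C BB[OF that(1) d that(2)] that(1) unfolding X_def by blast
    let ?B = "B(d := C)"
    have "\<forall>e\<in>insert d D. ?B e \<in> E"
      using BD C(1) by auto
    moreover have "\<forall>e\<in>hedges F - insert d D. ?B e \<in> shadow p E"
      using BS by auto
    moreover have "\<forall>e\<in>hedges F. ?B e \<inter> ?W = \<phi> ` e"
      using BW CW by auto
    moreover have "\<forall>e\<in>hedges F. \<forall>e'\<in>hedges F. e \<noteq> e' \<longrightarrow> ?B e \<inter> ?B e' \<subseteq> ?W"
    proof (intro ballI impI)
      fix e e' assume e: "e \<in> hedges F" "e' \<in> hedges F" "e \<noteq> e'"
      consider "e = d" | "e' = d" | "e \<noteq> d" "e' \<noteq> d"
        by blast
      then show "?B e \<inter> ?B e' \<subseteq> ?W"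
      proof cases
        case 1
        then show ?thesis using CB[OF e(2)] e(3) by simp
      next
        case 2
        then show ?thesis using CB[OF e(1)] e(3) by (simp add: Int_commute)
      next
        case 3
        then show ?thesis using BB[OF e] by simp
      qed
    qed
    ultimately show ?case
      by blast
  qed
  from this[OF finE subset_refl] obtain B where "\<forall>e\<in>hedges F. B e \<in> E"
    "\<forall>e\<in>hedges F. B e \<inter> ?W = \<phi> ` e"
    "\<forall>e\<in>hedges F. \<forall>e'\<in>hedges F. e \<noteq> e' \<longrightarrow> B e \<inter> B e' \<subseteq> ?W"
    by (elim exE conjE)
  then have "expands F (V, E) \<phi> B"
    using A unfolding expands_def by simp
  then show thesis ..
qed

section \<open>The upper bound on the extremal number\<close>

lemma ex_hyp_le_gen_ex_hyp:
  assumes F: "uniform_hypergraph 2 F" and "2 \<le> p" "p \<le> r"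
  shows "ex_hyp r n (expansion r F) \<le> gen_ex_hyp p n (complete_hypergraph p r) (expansion p F)
    + (card (verts F) + card (hedges F) * r) * n ^ (r - 1)"
  unfolding ex_hyp_def
proof (rule Sup_nat_le)
  \<comment> \<open>The number of vertices that the greedy extension may have to avoid; it does not
    depend on \<open>n\<close>.\<close>
  let ?c = "card (verts F) + card (hedges F) * r"
  fix x
  assume "x \<in> {card (hedges G) | G :: nat hypergraph.
    uniform_hypergraph r G \<and> card (verts G) = n \<and> hfree (expansion r F) G}"
  then obtain V :: "nat set" and E where x: "x = card E"
    and H: "uniform_hypergraph r (V, E)" and n: "card V = n"
    and free: "hfree (expansion r F) (V, E)"
    by auto
  have p: "0 < p"
    using assms(2) by simp
  obtain E' where E': "E' \<subseteq> E" "\<And>A. A \<in> shadow p E' \<Longrightarrow> extendable ?c E' A"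
    and card_E: "card E \<le> card E' + ?c * n ^ (r - 1)"
    using exists_extendable_subhypergraph[OF H assms(3) p, of ?c] n by auto
  let ?G = "(V, shadow p E')"
  have V: "finite V" and E: "\<And>B. B \<in> E \<Longrightarrow> B \<subseteq> V \<and> card B = r"
    using H unfolding uniform_hypergraph_def by auto
  have H': "uniform_hypergraph r (V, E')"
    using V E E'(1) unfolding uniform_hypergraph_def by auto
  have G: "uniform_hypergraph p ?G"
    using V E E'(1) unfolding uniform_hypergraph_def shadow_def by fastforce
  have "hfree (expansion p F) ?G"
  proof (rule ccontr)
    assume "\<not> ?thesis"
    then obtain \<phi> A where "expands F ?G \<phi> A"
      using expands_if_not_hfree_expansion[OF F] by blast
    then obtain B where "expands F (V, E') \<phi> B"
      using expands_if_expands_shadow[OF F H' assms(3) p E'(2)] by blast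
    then have "expands F (V, E) \<phi> B"
      using E'(1) unfolding expands_def by auto
    then show False
      using not_hfree_expansion_if_expands[OF F H] free by blast
  qed
  then have "card (cliques p r ?G) \<le> gen_ex_hyp p n (complete_hypergraph p r) (expansion p F)"
    using card_cliques_le_gen_ex_hyp[OF G, of n "expansion p F" r] n by simp
  \<comment> \<open>All \<open>p\<close>-subsets of a surviving hyperedge lie in the shadow of
    \<open>E'\<close>.\<close>
  moreover have "E' \<subseteq> cliques p r ?G"
    using E E'(1) unfolding cliques_def shadow_def by auto
  then have "card E' \<le> card (cliques p r ?G)"
    using V by (intro card_mono finite_cliques) auto
  ultimately show "x \<le>
      gen_ex_hyp p n (complete_hypergraph p r) (expansion p F) + ?c * n ^ (r - 1)"
    using card_E x by simp
qed

theorem theorem1p3: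
  fixes F :: "'a hypergraph" and r p :: nat
  assumes "uniform_hypergraph 2 F" and "2 \<le> p" and "p \<le> r"
  shows "(\<lambda>n::nat. real (ex_hyp r n (expansion r F))
            - real (gen_ex_hyp p n (complete_hypergraph p r) (expansion p F)))
         \<in> O(\<lambda>n. real n ^ (r - 1))"
proof (rule bigoI[where c = "real (card (verts F) + card (hedges F) * r)"], rule always_eventually, rule allI)
  fix n :: nat
  let ?x = "ex_hyp r n (expansion r F)"
  let ?g = "gen_ex_hyp p n (complete_hypergraph p r) (expansion p F)"
  let ?c = "card (verts F) + card (hedges F) * r"
  have "real ?x \<le> real (?g + ?c * n ^ (r - 1))"
    using ex_hyp_le_gen_ex_hyp[OF assms, of n] by (simp only: of_nat_le_iff)
  \<comment> \<open>This makes the difference nonnegative, so its norm is the difference itself and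
    the upper bound suffices.\<close>
  moreover have "real ?g \<le> real ?x"
    using gen_ex_hyp_le_ex_hyp[OF assms, of n] by simp
  ultimately show "norm (real ?x - real ?g) \<le> real ?c * norm (real n ^ (r - 1))"
    by simp
qed

end
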